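(* Let $m,n$ be positive integers and let $\mathcal{A}^I=[\underline{\mathcal{A}},\overline{\mathcal{A}}]$ be an interval Z-tensor in $T_{m,n}$. Then the following are equivalent: (a) $\mathcal{A}^I$ is an interval B-tensor. (b) $\sum_{i_2,\dots,i_m=1}^n\underline{a}_{i_1i_2\cdots i_m}>0$ for each $i_1\in[n]$. (c) $\underline{\mathcal{A}}$ is strictly diagonally dominant. (d) $\underline{\mathcal{A}}$ is a B-tensor.
   Context: $[n]=\{1,\dots,n\}$. $T_{m,n}$ is the set of real tensors $\mathcal{A}=(a_{i_1i_2\cdots i_m})$ with all indices in $[n]$; an entry is diagonal if all its indices are equal and off-diagonal otherwise. All index tuples $(i_2,\dots,i_m)$ range over $[n]^{m-1}$. For $\underline{\mathcal{A}}=(\underline{a}_{i_1\cdots i_m})\le\overline{\mathcal{A}}=(\overline{a}_{i_1\cdots i_m})$ in $T_{m,n}$ (entrywise), the interval tensor is $\mathcal{A}^I=[\underline{\mathcal{A}},\overline{\mathcal{A}}]=\{\mathcal{A}\in T_{m,n}:\underline{\mathcal{A}}\le\mathcal{A}\le\overline{\mathcal{A}}\}$. B-tensor: $\mathcal{A}\in T_{m,n}$ is a B-tensor if for all $i_1\in[n]$: $\sum_{i_2,\dots,i_m=1}^n a_{i_1i_2\cdots i_m}>0$, and $\frac{1}{n^{m-1}}\sum_{i_2,\dots,i_m=1}^n a_{i_1i_2\cdots i_m}>a_{i_1j_2\cdots j_m}$ for all $(j_2,\dots,j_m)\neq(i_1,\dots,i_1)$. Z-tensor: all off-diagonal entries are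 $\le 0$. Strictly diagonally dominant (dominated): $a_{i_1i_1\cdots i_1}>\sum_{(i_2,\dots,i_m)\neq(i_1,\dots,i_1)}|a_{i_1i_2\cdots i_m}|$ for all $i_1\in[n]$. $\mathcal{A}^I$ is an interval B-tensor (resp. interval Z-tensor) if every $\mathcal{A}\in\mathcal{A}^I$ is a B-tensor (resp. Z-tensor). *)

theory Defs
  imports Complex_Main "HOL-Library.FuncSet"
begin

definition index_tuples :: "nat \<Rightarrow> nat \<Rightarrow> nat list set" where
  "index_tuples k n = {is. set is \<subseteq> {1..n} \<and> length is = k}"

text \<open>
  A tensor of order \<open>m\<close> and dimension \<open>n\<close> is a real function on index tuples of length \<open>m\<close>.
  Extensionality fixes the value of the function off the index set, so that the elements of
  \<open>tensors m n\<close> correspond bijectively to the tensors.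
\<close>

definition tensors :: "nat \<Rightarrow> nat \<Rightarrow> (nat list \<Rightarrow> real) set" where
  "tensors m n = index_tuples m n \<rightarrow>\<^sub>E UNIV"

definition tensor_le :: "nat \<Rightarrow> nat \<Rightarrow> (nat list \<Rightarrow> real) \<Rightarrow> (nat list \<Rightarrow> real) \<Rightarrow> bool" where
  "tensor_le m n A B \<longleftrightarrow> (\<forall>is \<in> index_tuples m n. A is \<le> B is)"

definition interval_tensor ::
    "nat \<Rightarrow> nat \<Rightarrow> (nat list \<Rightarrow> real) \<Rightarrow> (nat list \<Rightarrow> real) \<Rightarrow> (nat list \<Rightarrow> real) set" where
  "interval_tensor m n L U = {A \<in> tensors m n. tensor_le m n L A \<and> tensor_le m n A U}"

definition diagonal_index :: "nat list \<Rightarrow> bool" where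
  "diagonal_index is \<longleftrightarrow> (\<forall>i \<in> set is. \<forall>j \<in> set is. i = j)"

definition Z_tensor :: "nat \<Rightarrow> nat \<Rightarrow> (nat list \<Rightarrow> real) \<Rightarrow> bool" where
  "Z_tensor m n A \<longleftrightarrow>
     A \<in> tensors m n \<and> (\<forall>is \<in> index_tuples m n. \<not> diagonal_index is \<longrightarrow> A is \<le> 0)"

text \<open>
  Below, \<open>i # js\<close> is the tuple with first index \<open>i\<close> and remaining indices \<open>js\<close>; the order \<open>m\<close>
  is meant to be positive, so \<open>m - 1\<close> is the true predecessor.
\<close>

definition B_tensor :: "nat \<Rightarrow> nat \<Rightarrow> (nat list \<Rightarrow> real) \<Rightarrow> bool" where
  "B_tensor m n A \<longleftrightarrow>
     A \<in> tensors m n \<and>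
     (\<forall>i \<in> {1..n}.
        (\<Sum>js \<in> index_tuples (m - 1) n. A (i # js)) > 0 \<and>
        (\<forall>js \<in> index_tuples (m - 1) n. js \<noteq> replicate (m - 1) i \<longrightarrow>
           1 / real n ^ (m - 1) * (\<Sum>ks \<in> index_tuples (m - 1) n. A (i # ks)) > A (i # js)))"

definition strictly_diagonally_dominant :: "nat \<Rightarrow> nat \<Rightarrow> (nat list \<Rightarrow> real) \<Rightarrow> bool" where
  "strictly_diagonally_dominant m n A \<longleftrightarrow>
     A \<in> tensors m n \<and>
     (\<forall>i \<in> {1..n}.
        A (replicate m i) >
          (\<Sum>js \<in> index_tuples (m - 1) n - {replicate (m - 1) i}. \<bar>A (i # js)\<bar>))"

definition interval_B_tensor ::
    "nat \<Rightarrow> nat \<Rightarrow> (nat list \<Rightarrow> real) \<Rightarrow> (nat list \<Rightarrow> real) \<Rightarrow> bool" where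
  "interval_B_tensor m n L U \<longleftrightarrow> (\<forall>A \<in> interval_tensor m n L U. B_tensor m n A)"

definition interval_Z_tensor ::
    "nat \<Rightarrow> nat \<Rightarrow> (nat list \<Rightarrow> real) \<Rightarrow> (nat list \<Rightarrow> real) \<Rightarrow> bool" where
  "interval_Z_tensor m n L U \<longleftrightarrow> (\<forall>A \<in> interval_tensor m n L U. Z_tensor m n A)"

end

theory Submission
  imports Defs
begin

text \<open>
  In a Z-tensor the only entry of row \<open>i\<close> that can be positive is the diagonal one, so
  \<open>\<bar>a\<bar> = -a\<close> for every other entry and the row sum is exactly the diagonal entry minus the sum
  of the absolute values of the off-diagonal entries. Strict diagonal dominance is therefore
  the same as positivity of all row sums (\<open>Z_tensor_diagonally_dominant_iff\<close>). Positive row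
  sums also make a Z-tensor a B-tensor, since the positive row mean exceeds the nonpositive
  off-diagonal entries (\<open>Z_tensor_B_tensor_iff\<close>).

  Row sums are monotone in the tensor, so among the members of an interval they are smallest
  at the lower bound. If they are positive there, they are positive on the whole interval, and
  every member, being a Z-tensor, is a B-tensor. Conversely the lower bound is itself a member
  of the interval.
\<close>

lemma finite_index_tuples: "finite (index_tuples k n)"
  unfolding index_tuples_def by (rule finite_lists_length_eq) simp

lemma replicate_in_index_tuples: "i \<in> {1..n} \<Longrightarrow> replicate k i \<in> index_tuples k n"
  by (auto simp: index_tuples_def)

lemma Cons_in_index_tuples:
  assumes "m > 0" and "i \<in> {1..n}" and "js \<in> index_tuples (m - 1) n"
  shows "i # js \<in> index_tuples m n"
  using assms by (auto simp: index_tuples_def)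

lemma diagonal_index_Cons_iff: "diagonal_index (i # js) \<longleftrightarrow> js = replicate (length js) i"
proof
  assume "diagonal_index (i # js)"
  then show "js = replicate (length js) i"
    by (simp add: diagonal_index_def replicate_length_same)
next
  assume "js = replicate (length js) i"
  then have "set js \<subseteq> {i}"
    by (metis set_replicate_conv_if empty_subsetI order_refl)
  then show "diagonal_index (i # js)"
    by (auto simp: diagonal_index_def)
qed

lemma Z_tensor_off_diagonal_nonpos:
  assumes "Z_tensor m n A" and "m > 0" and "i \<in> {1..n}"
    and js: "js \<in> index_tuples (m - 1) n" and "js \<noteq> replicate (m - 1) i"
  shows "A (i # js) \<le> 0"
proof -
  have "length js = m - 1"
    using js by (simp add: index_tuples_def)
  then have "\<not> diagonal_index (i # js)"
    using assms(5) by (simp add: diagonal_index_Cons_iff)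
  then show ?thesis
    using assms Cons_in_index_tuples by (simp add: Z_tensor_def)
qed

text \<open>
  Splitting off the diagonal entry leaves only nonpositive terms, whose absolute values are
  their negatives.
\<close>

lemma Z_tensor_row_sum:
  assumes "Z_tensor m n A" and "m > 0" and i: "i \<in> {1..n}"
  shows "(\<Sum>js \<in> index_tuples (m - 1) n. A (i # js)) =
    A (replicate m i) - (\<Sum>js \<in> index_tuples (m - 1) n - {replicate (m - 1) i}. \<bar>A (i # js)\<bar>)"
proof -
  let ?d = "replicate (m - 1) i"
  let ?off = "index_tuples (m - 1) n - {?d}"
  have "(\<Sum>js \<in> index_tuples (m - 1) n. A (i # js)) = A (i # ?d) + (\<Sum>js \<in> ?off. A (i # js))"
    by (rule sum.remove) (use i in \<open>auto simp: finite_index_tuples replicate_in_index_tuples\<close>)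
  also have "i # ?d = replicate m i"
    using \<open>m > 0\<close> by (cases m) auto
  also have "(\<Sum>js \<in> ?off. A (i # js)) = - (\<Sum>js \<in> ?off. \<bar>A (i # js)\<bar>)"
    unfolding sum_negf[symmetric]
    by (rule sum.cong) (use Z_tensor_off_diagonal_nonpos[OF assms] in auto)
  finally show ?thesis
    by simp
qed

lemma Z_tensor_diagonally_dominant_iff:
  assumes "Z_tensor m n A" and "m > 0"
  shows "strictly_diagonally_dominant m n A \<longleftrightarrow>
    (\<forall>i \<in> {1..n}. (\<Sum>js \<in> index_tuples (m - 1) n. A (i # js)) > 0)"
proof -
  have "A \<in> tensors m n"
    using assms(1) by (simp add: Z_tensor_def)
  moreover have "A (replicate m i) >
        (\<Sum>js \<in> index_tuples (m - 1) n - {replicate (m - 1) i}. \<bar>A (i # js)\<bar>) \<longleftrightarrow>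
      (\<Sum>js \<in> index_tuples (m - 1) n. A (i # js)) > 0" if "i \<in> {1..n}" for i
    using Z_tensor_row_sum[OF assms that] by linarith
  ultimately show ?thesis
    unfolding strictly_diagonally_dominant_def by blast
qed

text \<open>
  The second condition on a B-tensor is automatic here: a positive mean exceeds a nonpositive
  entry.
\<close>

lemma Z_tensor_B_tensor_iff:
  assumes "Z_tensor m n A" and "m > 0"
  shows "B_tensor m n A \<longleftrightarrow>
    (\<forall>i \<in> {1..n}. (\<Sum>js \<in> index_tuples (m - 1) n. A (i # js)) > 0)"
proof
  assume pos: "\<forall>i \<in> {1..n}. (\<Sum>js \<in> index_tuples (m - 1) n. A (i # js)) > 0"
  have "A (i # js) < 1 / real n ^ (m - 1) * (\<Sum>ks \<in> index_tuples (m - 1) n. A (i # ks))"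
    if i: "i \<in> {1..n}" and js: "js \<in> index_tuples (m - 1) n" "js \<noteq> replicate (m - 1) i"
    for i js
  proof -
    have "A (i # js) \<le> 0"
      using Z_tensor_off_diagonal_nonpos[OF assms i js] .
    also have "0 < 1 / real n ^ (m - 1) * (\<Sum>ks \<in> index_tuples (m - 1) n. A (i # ks))"
      using pos i by (intro mult_pos_pos) auto
    finally show ?thesis .
  qed
  then show "B_tensor m n A"
    using pos assms(1) by (simp add: B_tensor_def Z_tensor_def)
qed (simp add: B_tensor_def)

lemma row_sum_mono:
  assumes "tensor_le m n A B" and "m > 0" and "i \<in> {1..n}"
  shows "(\<Sum>js \<in> index_tuples (m - 1) n. A (i # js)) \<le> (\<Sum>js \<in> index_tuples (m - 1) n. B (i # js))"
  by (rule sum_mono) (use assms Cons_in_index_tuples in \<open>auto simp: tensor_le_def\<close>)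

theorem proposition3p1:
  fixes m n :: nat
    and L U :: "nat list \<Rightarrow> real"
  assumes "m > 0" and "n > 0"
    and "L \<in> tensors m n" and "U \<in> tensors m n"
    and "tensor_le m n L U"
    and "interval_Z_tensor m n L U"
  shows "(interval_B_tensor m n L U \<longleftrightarrow>
            (\<forall>i \<in> {1..n}. (\<Sum>js \<in> index_tuples (m - 1) n. L (i # js)) > 0))
       \<and> ((\<forall>i \<in> {1..n}. (\<Sum>js \<in> index_tuples (m - 1) n. L (i # js)) > 0) \<longleftrightarrow>
            strictly_diagonally_dominant m n L)
       \<and> (strictly_diagonally_dominant m n L \<longleftrightarrow> B_tensor m n L)"
proof -
  let ?pos = "\<lambda>A. \<forall>i \<in> {1..n}. (\<Sum>js \<in> index_tuples (m - 1) n. A (i # js)) > 0"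
  have L: "L \<in> interval_tensor m n L U"
    using assms(3,5) by (simp add: interval_tensor_def tensor_le_def)
  have Z: "Z_tensor m n A" if "A \<in> interval_tensor m n L U" for A
    using assms(6) that by (simp add: interval_Z_tensor_def)
  have "interval_B_tensor m n L U \<longleftrightarrow> (\<forall>A \<in> interval_tensor m n L U. ?pos A)"
    using Z_tensor_B_tensor_iff[OF Z \<open>m > 0\<close>] by (simp add: interval_B_tensor_def)
  also have "\<dots> \<longleftrightarrow> ?pos L"
  proof
    assume "\<forall>A \<in> interval_tensor m n L U. ?pos A"
    then show "?pos L"
      using L by (rule bspec)
  next
    assume "?pos L"
    moreover have "tensor_le m n L A" if "A \<in> interval_tensor m n L U" for A
      using that by (simp add: interval_tensor_def)
    ultimately show "\<forall>A \<in> interval_tensor m n L U. ?pos A"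
      using row_sum_mono[OF _ \<open>m > 0\<close>] by (meson less_le_trans)
  qed
  finally show ?thesis
    using Z_tensor_diagonally_dominant_iff[OF Z[OF L] \<open>m > 0\<close>]
      Z_tensor_B_tensor_iff[OF Z[OF L] \<open>m > 0\<close>]
    by blast
qed

end
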